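(* Let $k\geq 2$ be an integer and let $(b_1,\dots,b_k)$ be a $k$-tuple of natural numbers. For $x\geq 3$ put \[ g_k(x):=\frac{x}{\log x}-k\,\frac{4e\,(432)^2}{\log 4}. \] Let $M=M(k)$ be the smallest integer $M\geq 5$ such that $g_k(M-2)>0$. If $b_i\geq M$ for every $1\leq i\leq k$, then there are infinitely many natural numbers $N$ such that, for every $i\in\{1,\dots,k\}$, $N$ can be written in base $b_i$ without the digit $0$.
   Context: A natural number $N$ can be written in base $b$ without the digit $0$ if there is $j\in\mathbb{N}_0$ such that $N=\sum_{0\leq i\leq j}c_i b^i$ with all $c_i\in\{1,\dots,b-1\}$. Here $\log$ is the natural logarithm. *)

theory Defs
  imports Complex_Main
begin

definition zero_free :: "nat \<Rightarrow> nat \<Rightarrow> bool" where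
  "zero_free b N \<longleftrightarrow>
     (\<exists>j::nat. \<exists>c::nat \<Rightarrow> nat. (\<forall>i\<le>j. c i \<in> {1..<b}) \<and> N = (\<Sum>i\<le>j. c i * b ^ i))"

(* Intended for x >= 3 only; threshold evaluates it only at such arguments. *)
definition g :: "nat \<Rightarrow> real \<Rightarrow> real" where
  "g k x = x / ln x - real k * (4 * exp 1 * 432\<^sup>2 / ln 4)"

(* The least M exists because x / ln x tends to infinity. *)
definition threshold :: "nat \<Rightarrow> nat" where
  "threshold k = (LEAST M. 5 \<le> M \<and> g k (real M - 2) > 0)"

end

(* Base 4 multiscale counting. A positive N is zero-free in base b as soon as it avoids all the
   gaps [m b^(j+1), m b^(j+1) + b^j) with m \<ge> 1. Descend from the interval [0, 4^T) through its
   4-adic subintervals, discarding an interval of length 4^n once it meets a gap of length at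
   least 4^n. If 4^P \<le> b, the gaps of length about 4^n are at least 4^(n+P) apart, so among the
   descendants of a surviving interval of length 4^(n+P) they destroy at most 10 intervals of
   length 4^n. Hence the numbers of survivors satisfy
   s(t+1) \<ge> 4 s(t) - 10 k s(t+1-P), and if 10 k P \<le> 4^(P-1), induction shows
   s(t+1) \<ge> (4 - 2/P) s(t) \<ge> 2 s(t). *)
theory Submission
  imports Defs "HOL-Real_Asymp.Real_Asymp"
begin

section \<open>Zero digits as gaps\<close>

text \<open>A digit 0 at a position \<open>j\<close> below the leading digit puts \<open>N\<close>
  in the gap of length \<open>b ^ j\<close> starting at \<open>m * b ^ Suc j\<close>, where
  \<open>m = N div b ^ Suc j\<close> is at least 1. The induction strips the last digit: multiplying
  by \<open>b\<close> carries the gaps of level \<open>j\<close> around \<open>N div b\<close> to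
  gaps of level \<open>Suc j\<close> around \<open>N\<close>.\<close>

lemma zero_freeI:
  assumes "2 \<le> b" "N \<noteq> 0"
    and "\<And>j m. 1 \<le> m \<Longrightarrow> m * b ^ Suc j \<le> N \<Longrightarrow> m * b ^ Suc j + b ^ j \<le> N"
  shows "zero_free b N"
  using assms(2,3)
proof (induction N rule: less_induct)
  case (less N)
  show ?case
  proof (cases "N < b")
    case True
    then show ?thesis
      unfolding zero_free_def using less.prems(1)
      by (intro exI[of _ 0] exI[of _ "\<lambda>_. N"]) auto
  next
    case False
    let ?N = "N div b"
    have pos: "?N \<noteq> 0" using False assms(1) by (simp add: div_eq_0_iff)
    have "?N < N" using assms(1) less.prems(1) by simp
    moreover have "m * b ^ Suc j + b ^ j \<le> ?N" if "1 \<le> m" "m * b ^ Suc j \<le> ?N" for j m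
    proof -
      have "m * b ^ Suc j * b \<le> N"
        using that(2) assms(1) by (simp add: less_eq_div_iff_mult_less_eq)
      with less.prems(2)[OF that(1), of "Suc j"] have "(m * b ^ Suc j + b ^ j) * b \<le> N"
        by (simp add: algebra_simps)
      then show ?thesis using assms(1) by (simp add: less_eq_div_iff_mult_less_eq)
    qed
    ultimately have "zero_free b ?N" using less.IH pos by blast
    then obtain j c where c: "\<forall>i\<le>j. c i \<in> {1..<b}" and N: "?N = (\<Sum>i\<le>j. c i * b ^ i)"
      unfolding zero_free_def by blast
    \<comment> \<open>The gap of length 1 at \<open>?N * b\<close> excludes a last digit 0.\<close>
    have "?N * b + 1 \<le> N"
      using less.prems(2)[of ?N 0] pos by simp
    then have r: "N mod b \<in> {1..<b}"
    proof -
      have "N div b * b + N mod b = N" "N mod b < b" using assms(1) by auto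
      with \<open>?N * b + 1 \<le> N\<close> have "1 \<le> N mod b" by linarith
      with \<open>N mod b < b\<close> show ?thesis by simp
    qed
    define d where "d = case_nat (N mod b) c"
    have "\<forall>i\<le>Suc j. d i \<in> {1..<b}"
      using c r by (auto simp: d_def split: nat.split)
    moreover have "(\<Sum>i\<le>Suc j. d i * b ^ i) = N"
    proof -
      have "(\<Sum>i\<le>Suc j. d i * b ^ i) = N mod b + (\<Sum>i\<le>j. c i * b ^ i) * b"
        by (simp add: sum.atMost_Suc_shift d_def sum_distrib_left mult_ac
            del: sum.atMost_Suc)
      then show ?thesis by (simp flip: N)
    qed
    ultimately show ?thesis unfolding zero_free_def by metis
  qed
qed

section \<open>4-adic intervals and survivors\<close>

text \<open>The \<open>x\<close>-th 4-adic interval of length \<open>4 ^ n\<close> meets a gap of length \<open>b ^ j\<close>. The leading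
  zeros \<open>m = 0\<close> are not digits.\<close>

definition meets_gap :: "nat \<Rightarrow> nat \<Rightarrow> nat \<Rightarrow> nat \<Rightarrow> bool" where
  "meets_gap b n j x \<longleftrightarrow>
     (\<exists>m\<ge>1. x * 4 ^ n < m * b ^ Suc j + b ^ j \<and> m * b ^ Suc j < (x + 1) * 4 ^ n)"

text \<open>Survival is a condition on all ancestors at once rather than a recursion over scales. At
  \<open>n = 0\<close> every gap of a positive base has length at least \<open>4 ^ n\<close>, so
  survivors there avoid all gaps.\<close>

definition survivors :: "nat set \<Rightarrow> nat \<Rightarrow> nat \<Rightarrow> nat set" where
  "survivors B T n = {x. x * 4 ^ n < 4 ^ T \<and>
     (\<forall>b\<in>B. \<forall>p j. 4 ^ (n + p) \<le> b ^ j \<longrightarrow> \<not> meets_gap b (n + p) j (x div 4 ^ p))}"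

lemma meets_gap_ancestor:
  assumes "meets_gap b n j x"
  shows "meets_gap b (n + p) j (x div 4 ^ p)"
proof -
  obtain m where m: "1 \<le> m" "x * 4 ^ n < m * b ^ Suc j + b ^ j" "m * b ^ Suc j < (x + 1) * 4 ^ n"
    using assms unfolding meets_gap_def by blast
  have "x div 4 ^ p * 4 ^ p \<le> x" by simp
  then have "x div 4 ^ p * 4 ^ p * 4 ^ n \<le> x * 4 ^ n" by (rule mult_right_mono) simp
  then have 1: "x div 4 ^ p * 4 ^ (n + p) \<le> x * 4 ^ n" by (simp add: power_add mult_ac)
  have "x + 1 \<le> (x div 4 ^ p + 1) * 4 ^ p"
    using dividend_less_div_times[of "4 ^ p" x] by simp
  then have "(x + 1) * 4 ^ n \<le> (x div 4 ^ p + 1) * 4 ^ p * 4 ^ n" by (rule mult_right_mono) simp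
  then have 2: "(x + 1) * 4 ^ n \<le> (x div 4 ^ p + 1) * 4 ^ (n + p)"
    by (simp add: power_add mult_ac)
  show ?thesis unfolding meets_gap_def
    using m 1 2 by (intro exI[of _ m] conjI) linarith+
qed

lemma finite_survivors: "finite (survivors B T n)"
proof (rule finite_subset)
  show "survivors B T n \<subseteq> {..<4 ^ T}"
  proof
    fix x assume "x \<in> survivors B T n"
    then have "x * 4 ^ n < 4 ^ T" by (simp add: survivors_def)
    moreover have "x \<le> x * 4 ^ n" by simp
    ultimately have "x < 4 ^ T" by (rule le_less_trans[rotated])
    then show "x \<in> {..<4 ^ T}" by simp
  qed
qed simp

lemma survivors_ancestor:
  assumes "x \<in> survivors B T n"
  shows "x div 4 ^ p \<in> survivors B T (n + p)"
proof -
  have "x div 4 ^ p * 4 ^ (n + p) = x div 4 ^ p * 4 ^ p * 4 ^ n"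
    by (simp add: power_add mult_ac)
  also have "\<dots> \<le> x * 4 ^ n" by (rule mult_right_mono) simp_all
  also have "\<dots> < 4 ^ T" using assms by (simp add: survivors_def)
  finally have "x div 4 ^ p * 4 ^ (n + p) < 4 ^ T" .
  moreover have "\<not> meets_gap b (n + p + q) j (x div 4 ^ p div 4 ^ q)"
    if "b \<in> B" "4 ^ (n + p + q) \<le> b ^ j" for b q j
    using assms that unfolding survivors_def
    by (auto simp: div_mult2_eq[symmetric] power_add[symmetric] add.assoc)
  ultimately show ?thesis by (simp add: survivors_def)
qed

text \<open>This is the root of the descent: a gap of length at least \<open>4 ^ (T + p)\<close>
  starts no earlier than its own length, hence beyond \<open>[0, 4 ^ (T + p))\<close>.\<close>

lemma zero_in_survivors_top:
  assumes "\<forall>b\<in>B. 1 \<le> b"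
  shows "0 \<in> survivors B T T"
proof -
  have False if "b \<in> B" "4 ^ (T + p) \<le> b ^ j" "meets_gap b (T + p) j 0" for b p j
  proof -
    obtain m where m: "1 \<le> m" "m * b ^ Suc j < 4 ^ (T + p)"
      using \<open>meets_gap b (T + p) j 0\<close> by (auto simp: meets_gap_def)
    have "1 * b ^ j \<le> (m * b) * b ^ j"
      using m(1) assms that(1) by (intro mult_right_mono) auto
    also have "\<dots> = m * b ^ Suc j" by simp
    finally show False using m(2) that(2) by linarith
  qed
  then show ?thesis by (auto simp: survivors_def)
qed

section \<open>Losses caused by one base at one scale\<close>

text \<open>Gap starts are \<open>b ^ Suc j\<close> apart, at least the length
  \<open>4 ^ (n + P)\<close> of interval \<open>y\<close>, so at most two gaps are relevant. Each is
  shorter than \<open>4 * 4 ^ n\<close> and so meets at most 5 intervals of length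
  \<open>4 ^ n\<close>.\<close>

lemma card_descendants_meeting_gap:
  assumes b: "4 ^ P \<le> b" and j: "4 ^ n \<le> b ^ j" "b ^ j < 4 ^ Suc n"
  shows "finite {x. x div 4 ^ P = y \<and> meets_gap b n j x}"
    and "card {x. x div 4 ^ P = y \<and> meets_gap b n j x} \<le> 10"
proof -
  define D where "D = b ^ Suc j"
  define A :: nat where "A = 4 ^ (n + P)"
  have D: "b ^ j \<le> D" "A \<le> D" "0 < D"
  proof -
    have "1 \<le> b" using b by (metis one_le_numeral one_le_power order_trans)
    then show "b ^ j \<le> D" "0 < D" by (auto simp: D_def)
    show "A \<le> D" using mult_mono[OF j(1) b] by (simp add: A_def D_def power_add mult_ac)
  qed
  let ?I = "\<lambda>m. {m * D div 4 ^ n .. m * D div 4 ^ n + 4}"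
  let ?m = "y * A div D"
  have sub: "{x. x div 4 ^ P = y \<and> meets_gap b n j x} \<subseteq> ?I ?m \<union> ?I (?m + 1)"
  proof
    fix x assume "x \<in> {x. x div 4 ^ P = y \<and> meets_gap b n j x}"
    then have y: "x div 4 ^ P = y" and x: "meets_gap b n j x" by auto
    obtain m where m: "x * 4 ^ n < m * D + b ^ j" "m * D < (x + 1) * 4 ^ n"
      using x unfolding meets_gap_def D_def by blast
    have "y * 4 ^ P \<le> x" using y by auto
    then have "y * 4 ^ P * 4 ^ n \<le> x * 4 ^ n" by (rule mult_right_mono) simp
    then have yA: "y * A \<le> x * 4 ^ n" by (simp add: A_def power_add mult_ac)
    have "x + 1 \<le> (y + 1) * 4 ^ P"
      using dividend_less_div_times[of "4 ^ P" x] y by simp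
    then have "(x + 1) * 4 ^ n \<le> (y + 1) * 4 ^ P * 4 ^ n" by (rule mult_right_mono) simp
    then have yA': "(x + 1) * 4 ^ n \<le> y * A + A" by (simp add: A_def power_add algebra_simps)
    have "y * A < (m + 1) * D" using yA m(1) D(1) by (simp add: algebra_simps)
    then have "?m < m + 1" using D(3) by (simp add: div_less_iff_less_mult)
    moreover have "m < ?m + 2"
    proof -
      have "y * A < (?m + 1) * D" using dividend_less_div_times[OF D(3), of "y * A"] by simp
      \<comment> \<open>The gap starts before the end \<open>y * A + A\<close> of interval
        \<open>y\<close>, and \<open>A \<le> D\<close>.\<close>
      then have "m * D < (?m + 2) * D" using m(2) yA' D(2) by (simp add: algebra_simps)
      then show ?thesis by (simp only: mult_less_cancel2)
    qed
    ultimately have mm: "m = ?m \<or> m = ?m + 1" by linarith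
    let ?q = "m * D div 4 ^ n"
    have "?q < x + 1" using m(2) by (simp add: div_less_iff_less_mult)
    moreover have "x < ?q + 5"
    proof -
      have "m * D < (?q + 1) * 4 ^ n"
        using dividend_less_div_times[of "4 ^ n" "m * D"] by simp
      then have "x * 4 ^ n < (?q + 5) * 4 ^ n" using m(1) j(2) by (simp add: algebra_simps)
      then show ?thesis by simp
    qed
    ultimately have "x \<in> ?I m" by simp
    then show "x \<in> ?I ?m \<union> ?I (?m + 1)" using mm by auto
  qed
  show "finite {x. x div 4 ^ P = y \<and> meets_gap b n j x}"
    by (rule finite_subset[OF sub]) simp
  have "card {x. x div 4 ^ P = y \<and> meets_gap b n j x} \<le> card (?I ?m \<union> ?I (?m + 1))"
    by (rule card_mono[OF _ sub]) simp
  also have "\<dots> \<le> card (?I ?m) + card (?I (?m + 1))" by (rule card_Un_le)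
  also have "\<dots> = 10" by simp
  finally show "card {x. x div 4 ^ P = y \<and> meets_gap b n j x} \<le> 10" .
qed

text \<open>The upper bound on \<open>b ^ j\<close> singles out the gaps that are new at this scale:
  a longer one would already have discarded the parent.\<close>

definition killed :: "nat set \<Rightarrow> nat \<Rightarrow> nat \<Rightarrow> nat \<Rightarrow> nat set" where
  "killed B T n b = {x. x div 4 \<in> survivors B T (Suc n) \<and>
     (\<exists>j. 4 ^ n \<le> b ^ j \<and> b ^ j < 4 ^ Suc n \<and> meets_gap b n j x)}"

text \<open>Since \<open>n < T\<close>, the length \<open>4 ^ Suc n\<close> divides
  \<open>4 ^ T\<close>, so a parent starting below \<open>4 ^ T\<close> lies entirely below it, and
  so do its children.\<close>

lemma child_range:
  assumes "n < T" "x div 4 \<in> survivors B T (Suc n)"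
  shows "(x + 1) * 4 ^ n \<le> 4 ^ T"
proof -
  have T: "(4::nat) ^ T = 4 ^ (T - Suc n) * 4 ^ Suc n"
    using assms(1) by (simp flip: power_add del: power_Suc)
  have "x div 4 * 4 ^ Suc n < 4 ^ (T - Suc n) * 4 ^ Suc n"
    using assms(2) by (simp only: survivors_def mem_Collect_eq T)
  then have "x div 4 < 4 ^ (T - Suc n)" by simp
  then have "x + 1 \<le> 4 ^ (T - Suc n) * 4" by linarith
  then have "(x + 1) * 4 ^ n \<le> 4 ^ (T - Suc n) * 4 * 4 ^ n" by (rule mult_right_mono) simp
  then show ?thesis by (simp add: T mult_ac)
qed

lemma children_subset:
  assumes "n < T"
  shows "{x. x div 4 \<in> survivors B T (Suc n)} \<subseteq> survivors B T n \<union> (\<Union>b\<in>B. killed B T n b)"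
proof
  fix x assume "x \<in> {x. x div 4 \<in> survivors B T (Suc n)}"
  then have x: "x div 4 \<in> survivors B T (Suc n)" by simp
  show "x \<in> survivors B T n \<union> (\<Union>b\<in>B. killed B T n b)"
  proof (cases "x \<in> survivors B T n")
    case False
    have "x * 4 ^ n < (x + 1) * 4 ^ n" by simp
    with child_range[OF assms x] have "x * 4 ^ n < 4 ^ T" by linarith
    with False obtain b p j where b: "b \<in> B" and j: "4 ^ (n + p) \<le> b ^ j"
      and meets: "meets_gap b (n + p) j (x div 4 ^ p)"
      unfolding survivors_def by auto
    have none: "\<not> meets_gap b (Suc n + q) j (x div 4 div 4 ^ q)" if "4 ^ (Suc n + q) \<le> b ^ j" for q
      using x b that unfolding survivors_def by blast
    \<comment> \<open>For \<open>p = Suc q\<close> the offending interval would be an ancestor of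
      the surviving parent.\<close>
    have p: "p = 0"
    proof (cases p)
      case (Suc q)
      then show ?thesis using none[of q] j meets by (simp add: div_mult2_eq)
    qed
    \<comment> \<open>Otherwise the same gap would count against the parent, which contains interval
      \<open>x\<close>.\<close>
    have "b ^ j < 4 ^ Suc n"
      using none[of 0] meets_gap_ancestor[of b n j x 1] meets p by (intro not_le_imp_less) auto
    then show ?thesis using x b j meets p unfolding killed_def by auto
  qed simp
qed

text \<open>Only one exponent \<open>j\<close> is active at a given scale, and every killed interval
  descends from a survivor of length \<open>4 ^ (n + P)\<close>, each of which loses at most 10
  descendants. When \<open>n + P > T\<close> the first gap of that level starts beyond
  \<open>4 ^ T\<close>.\<close>

lemma finite_card_killed:
  assumes n: "n < T" and P: "1 \<le> P" and b: "4 ^ P \<le> b"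
  shows "finite (killed B T n b)"
    and "card (killed B T n b) \<le> (if n + P \<le> T then 10 * card (survivors B T (n + P)) else 0)"
proof -
  have "finite (killed B T n b) \<and>
    card (killed B T n b) \<le> (if n + P \<le> T then 10 * card (survivors B T (n + P)) else 0)"
  proof (cases "killed B T n b = {}")
    case False
    then obtain x j where x: "x div 4 \<in> survivors B T (Suc n)"
      and j: "4 ^ n \<le> b ^ j" "b ^ j < 4 ^ Suc n" and meets: "meets_gap b n j x"
      unfolding killed_def by blast
    have b4: "4 \<le> b"
      using P b power_increasing[of 1 P "4::nat"] by simp
    \<comment> \<open>Consecutive powers of \<open>b\<close> differ by a factor of at least 4, so at
      most one lies in \<open>[4 ^ n, 4 ^ Suc n)\<close>.\<close>
    have unique: "i = j" if "4 ^ n \<le> b ^ i" "b ^ i < 4 ^ Suc n" for i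
    proof (rule ccontr)
      have *: False if "4 ^ n \<le> b ^ u" "b ^ v < 4 ^ Suc n" "u < v" for u v
      proof -
        have "4 ^ Suc n \<le> b ^ Suc u" using mult_mono[OF b4 that(1)] by simp
        also have "b ^ Suc u \<le> b ^ v"
          using that(3) b4 by (intro power_increasing) linarith+
        finally show False using that(2) by simp
      qed
      assume "i \<noteq> j"
      then show False using *[of i j] *[of j i] that j by linarith
    qed
    obtain m where m: "1 \<le> m" "m * b ^ Suc j < (x + 1) * 4 ^ n"
      using meets unfolding meets_gap_def by blast
    have "4 ^ (n + P) \<le> b ^ Suc j" using mult_mono[OF j(1) b] by (simp add: power_add mult_ac)
    also have "\<dots> \<le> m * b ^ Suc j" using m(1) by (cases m) simp_all
    also have "\<dots> < 4 ^ T" using m(2) child_range[OF n x] by linarith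
    finally have nP: "n + P \<le> T" by simp
    let ?D = "\<lambda>y. {x. x div 4 ^ P = y \<and> meets_gap b n j x}"
    let ?S = "survivors B T (n + P)"
    have sub: "killed B T n b \<subseteq> (\<Union>y\<in>?S. ?D y)"
    proof
      fix z assume "z \<in> killed B T n b"
      then have z: "z div 4 \<in> survivors B T (Suc n)" "meets_gap b n j z"
        using unique unfolding killed_def by auto
      \<comment> \<open>Interval \<open>z\<close> need not survive, but its parent does; as
        \<open>P \<ge> 1\<close>, the ancestor at scale \<open>n + P\<close> is reached through the
        parent.\<close>
      obtain q where q: "P = Suc q" using P by (cases P) auto
      have "z div 4 div 4 ^ q \<in> survivors B T (Suc n + q)"
        by (rule survivors_ancestor[OF z(1)])
      then show "z \<in> (\<Union>y\<in>?S. ?D y)" using z(2) by (auto simp: q div_mult2_eq)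
    qed
    have fin: "finite (\<Union>y\<in>?S. ?D y)"
      using card_descendants_meeting_gap(1)[OF b j] finite_survivors by blast
    have "card (killed B T n b) \<le> card (\<Union>y\<in>?S. ?D y)" by (rule card_mono[OF fin sub])
    also have "\<dots> \<le> (\<Sum>y\<in>?S. card (?D y))" by (rule card_UN_le[OF finite_survivors])
    also have "\<dots> \<le> (\<Sum>y\<in>?S. 10)" by (rule sum_mono) (rule card_descendants_meeting_gap(2)[OF b j])
    finally show ?thesis using nP finite_subset[OF sub fin] by simp
  qed simp
  then show "finite (killed B T n b)"
    "card (killed B T n b) \<le> (if n + P \<le> T then 10 * card (survivors B T (n + P)) else 0)"
    by auto
qed

section \<open>Growth of the survivor counts\<close>

lemma card_children:
  assumes "finite S"
  shows "card {x::nat. x div 4 \<in> S} = 4 * card S"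
proof -
  have "bij_betw (\<lambda>(y, r). 4 * y + r) (S \<times> {..<4}) {x::nat. x div 4 \<in> S}"
    by (rule bij_betw_byWitness[where f' = "\<lambda>x. (x div 4, x mod 4)"]) auto
  from bij_betw_same_card[OF this] show ?thesis by (simp add: card_cartesian_product)
qed

lemma card_survivors_recursion:
  assumes B: "finite B" "\<forall>b\<in>B. 4 ^ P \<le> b" and P: "1 \<le> P" and n: "n < T"
  shows "4 * card (survivors B T (Suc n)) \<le> card (survivors B T n) +
    (if n + P \<le> T then 10 * card B * card (survivors B T (n + P)) else 0)"
proof -
  let ?c = "if n + P \<le> T then 10 * card (survivors B T (n + P)) else 0"
  have fin: "finite (survivors B T n \<union> (\<Union>b\<in>B. killed B T n b))"
    using B finite_card_killed(1)[OF n P] finite_survivors by blast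
  have "4 * card (survivors B T (Suc n)) = card {x. x div 4 \<in> survivors B T (Suc n)}"
    by (rule card_children[OF finite_survivors, symmetric])
  also have "\<dots> \<le> card (survivors B T n \<union> (\<Union>b\<in>B. killed B T n b))"
    by (rule card_mono[OF fin children_subset[OF n]])
  also have "\<dots> \<le> card (survivors B T n) + card (\<Union>b\<in>B. killed B T n b)" by (rule card_Un_le)
  also have "card (\<Union>b\<in>B. killed B T n b) \<le> (\<Sum>b\<in>B. card (killed B T n b))"
    by (rule card_UN_le[OF B(1)])
  also have "\<dots> \<le> (\<Sum>b\<in>B. ?c)"
    using finite_card_killed(2)[OF n P] B(2) by (intro sum_mono) blast
  also have "\<dots> = (if n + P \<le> T then 10 * card B * card (survivors B T (n + P)) else 0)" by simp
  finally show ?thesis by simp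
qed

text \<open>Growth at the previous \<open>q\<close> steps gives
  \<open>\<rho> ^ q * s (t - q) \<le> s t\<close>, so \<open>crit\<close> bounds the delayed loss by
  \<open>(4 - \<rho>) * s t\<close>, leaving \<open>\<rho> * s t\<close>. For \<open>t < q\<close>
  there is no loss yet, and the factor is 4.\<close>

lemma growth_from_delayed_recursion:
  fixes s :: "nat \<Rightarrow> real" and \<rho> C :: real
  assumes nonneg: "\<And>t. 0 \<le> s t" and \<rho>: "0 < \<rho>" "\<rho> \<le> 4"
    and crit: "C \<le> (4 - \<rho>) * \<rho> ^ q"
    and rec: "\<And>t. t < T \<Longrightarrow> 4 * s t \<le> s (Suc t) + (if q \<le> t then C * s (t - q) else 0)"
  shows "t < T \<Longrightarrow> \<rho> * s t \<le> s (Suc t)"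
proof (induction t rule: less_induct)
  case (less t)
  show ?case
  proof (cases "q \<le> t")
    case True
    have "\<rho> ^ i * s (t - q) \<le> s (t - q + i)" if "i \<le> q" for i
      using that
    proof (induction i)
      case (Suc i)
      have "\<rho> ^ Suc i * s (t - q) = \<rho> * (\<rho> ^ i * s (t - q))" by simp
      also have "\<dots> \<le> \<rho> * s (t - q + i)" using Suc \<rho> by (intro mult_left_mono) auto
      also have "\<dots> \<le> s (Suc (t - q + i))"
        using Suc.prems True less.prems by (intro less.IH) auto
      finally show ?case by simp
    qed simp
    from this[of q] True have "\<rho> ^ q * s (t - q) \<le> s t" by simp
    then have "(4 - \<rho>) * (\<rho> ^ q * s (t - q)) \<le> (4 - \<rho>) * s t"
      using \<rho> by (intro mult_left_mono) auto
    moreover have "C * s (t - q) \<le> (4 - \<rho>) * \<rho> ^ q * s (t - q)"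
      using crit nonneg by (intro mult_right_mono) auto
    ultimately show ?thesis using rec[OF less.prems] True by (simp add: algebra_simps)
  next
    case False
    have "\<rho> * s t \<le> 4 * s t" using \<rho> nonneg by (intro mult_right_mono) auto
    then show ?thesis using rec[OF less.prems] False by simp
  qed
qed

lemma card_survivors_ge:
  assumes B: "finite B" "\<forall>b\<in>B. 4 ^ Suc q \<le> b" and crit: "10 * card B * Suc q \<le> 4 ^ q"
  shows "2 ^ T \<le> card (survivors B T 0)"
proof -
  \<comment> \<open>Time \<open>t\<close> counts subdivisions, so the scale is
    \<open>T - t\<close>.\<close>
  define s where "s t = real (card (survivors B T (T - t)))" for t
  define \<rho> :: real where "\<rho> = 4 - 2 / Suc q"
  have \<rho>: "2 \<le> \<rho>" "\<rho> \<le> 4" by (simp_all add: \<rho>_def field_simps)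
  \<comment> \<open>With \<open>P = Suc q\<close>, Bernoulli's inequality gives
    \<open>(\<rho> / 4) ^ q \<ge> 1 - q / (2 * P) \<ge> 1 / 2\<close>, hence
    \<open>(4 - \<rho>) * \<rho> ^ q \<ge> 4 ^ q / P\<close>.\<close>
  have crit': "10 * real (card B) \<le> (4 - \<rho>) * \<rho> ^ q"
  proof -
    have "1 / 2 \<le> 1 + real q * (- (1 / (2 * Suc q)))" by (simp add: field_simps)
    also have "\<dots> \<le> (1 + - (1 / (2 * Suc q))) ^ q"
      by (rule Bernoulli_inequality) (simp add: field_simps)
    finally have "4 ^ q * (1 / 2) \<le> 4 ^ q * (1 + - (1 / (2 * real (Suc q)))) ^ q"
      by (intro mult_left_mono) auto
    also have "\<dots> = \<rho> ^ q"
    proof -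
      have "4 * (1 + - (1 / (2 * real (Suc q)))) = \<rho>" by (simp add: \<rho>_def field_simps)
      then show ?thesis by (simp only: flip: power_mult_distrib)
    qed
    finally have *: "4 ^ q / 2 \<le> \<rho> ^ q" by simp
    have "real (10 * card B * Suc q) \<le> real (4 ^ q)" using crit by (simp only: of_nat_le_iff)
    then have "10 * real (card B) \<le> 4 ^ q / Suc q" by (simp add: pos_le_divide_eq algebra_simps)
    also have "\<dots> = (4 - \<rho>) * (4 ^ q / 2)" by (simp add: \<rho>_def field_simps)
    also have "\<dots> \<le> (4 - \<rho>) * \<rho> ^ q" using * \<rho> by (intro mult_left_mono) auto
    finally show ?thesis .
  qed
  have rec: "4 * s t \<le> s (Suc t) + (if q \<le> t then 10 * real (card B) * s (t - q) else 0)"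
    if "t < T" for t
  proof -
    define n where "n = T - Suc t"
    have n: "n < T" "T - t = Suc n" "T - Suc t = n" using that unfolding n_def by linarith+
    have "real (4 * card (survivors B T (Suc n))) \<le> real (card (survivors B T n) +
      (if n + Suc q \<le> T then 10 * card B * card (survivors B T (n + Suc q)) else 0))"
      unfolding of_nat_le_iff by (rule card_survivors_recursion[OF B _ n(1)]) simp
    then have le: "4 * s t \<le> s (Suc t) + real
      (if n + Suc q \<le> T then 10 * card B * card (survivors B T (n + Suc q)) else 0)"
      by (simp only: s_def n of_nat_add of_nat_mult of_nat_numeral)
    show ?thesis
    proof (cases "q \<le> t")
      case True
      \<comment> \<open>The delay is \<open>q\<close> although the scales involved are
        \<open>n\<close> and \<open>n + Suc q\<close>, because \<open>n\<close> belongs to time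
        \<open>Suc t\<close>.\<close>
      have "n + Suc q \<le> T" "T - (t - q) = n + Suc q" using True that unfolding n_def by linarith+
      with le True show ?thesis
        by (simp only: s_def if_True of_nat_mult of_nat_numeral)
    next
      case False
      have "\<not> n + Suc q \<le> T" using False that unfolding n_def by linarith
      with le False show ?thesis by (simp only: if_False of_nat_0)
    qed
  qed
  have growth: "\<rho> * s t \<le> s (Suc t)" if "t < T" for t
  proof (rule growth_from_delayed_recursion
      [where s = s and \<rho> = \<rho> and C = "10 * real (card B)" and q = q and T = T])
    show "0 \<le> s u" for u by (simp add: s_def)
    show "0 < \<rho>" "\<rho> \<le> 4" using \<rho> by linarith+
  qed (fact crit' rec that)+
  have "2 ^ t \<le> s t" if "t \<le> T" for t
    using that
  proof (induction t)
    case 0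
    have "\<forall>b\<in>B. 1 \<le> b" using B(2) by (metis one_le_numeral one_le_power order_trans)
    then have "0 \<in> survivors B T T" by (rule zero_in_survivors_top)
    then have "card (survivors B T T) \<noteq> 0" by (auto simp: card_eq_0_iff finite_survivors)
    then show ?case by (simp add: s_def)
  next
    case (Suc t)
    have "2 * 2 ^ t \<le> \<rho> * s t" using Suc \<rho> by (intro mult_mono) auto
    with growth[of t] Suc.prems show ?case by simp
  qed
  from this[of T] have "real (2 ^ T) \<le> real (card (survivors B T 0))" by (simp add: s_def)
  then show ?thesis by (simp only: of_nat_le_iff)
qed

section \<open>Infinitely many common zero-free numbers\<close>

lemma infinite_zero_free:
  assumes B: "finite B" "\<forall>b\<in>B. 4 ^ Suc q \<le> b" and crit: "10 * card B * Suc q \<le> 4 ^ q"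
  shows "infinite {N. \<forall>b\<in>B. zero_free b N}"
proof
  let ?Z = "{N. \<forall>b\<in>B. zero_free b N}"
  assume fin: "finite ?Z"
  \<comment> \<open>This choice makes the bound \<open>2 ^ T\<close> on the survivors exceed the
    size of the set containing them. The number 0 is adjoined because \<open>zero_freeI\<close>
    covers only nonzero survivors.\<close>
  define T where "T = card (insert 0 ?Z)"
  have "survivors B T 0 \<subseteq> insert 0 ?Z"
  proof
    fix N assume N: "N \<in> survivors B T 0"
    have "zero_free b N" if "b \<in> B" "N \<noteq> 0" for b
    proof (rule zero_freeI)
      have "4 ^ Suc q \<le> b" using B(2) that(1) by blast
      moreover have "4 * 1 \<le> (4::nat) ^ Suc q" by simp
      ultimately show b: "2 \<le> b" by linarith
      fix j m :: nat assume m: "1 \<le> m" "m * b ^ Suc j \<le> N"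
      have "4 ^ (0 + 0) \<le> b ^ j" using b by simp
      then have "\<not> meets_gap b (0 + 0) j (N div 4 ^ 0)"
        using N that(1) unfolding survivors_def by blast
      then show "m * b ^ Suc j + b ^ j \<le> N"
        using m unfolding meets_gap_def by (auto simp: not_less[symmetric])
    qed (use that in auto)
    then show "N \<in> insert 0 ?Z" by auto
  qed
  then have "card (survivors B T 0) \<le> T" unfolding T_def using fin by (intro card_mono) auto
  with card_survivors_ge[OF B crit, of T] less_exp[of T] show False by linarith
qed

section \<open>From the threshold to a scale\<close>

text \<open>Divergence of \<open>x / ln x\<close> supplies a witness, without which
  \<open>LEAST\<close> would carry no information.\<close>

lemma threshold_properties:
  shows "5 \<le> threshold k" and "0 < g k (real (threshold k) - 2)"
proof -
  have "filterlim (\<lambda>M::nat. (real M - 2) / ln (real M - 2)) at_top sequentially" by real_asymp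
  then have "eventually (\<lambda>M::nat. real k * (4 * exp 1 * 432\<^sup>2 / ln 4) <
      (real M - 2) / ln (real M - 2)) sequentially"
    by (simp add: filterlim_at_top_dense)
  then have "eventually (\<lambda>M::nat. 5 \<le> M \<and> 0 < g k (real M - 2)) sequentially"
    using eventually_ge_at_top[of "5::nat"] by eventually_elim (simp add: g_def)
  then obtain M :: nat where "5 \<le> M \<and> 0 < g k (real M - 2)"
    using eventually_happens'[OF sequentially_bot] by blast
  from LeastI[of "\<lambda>M. 5 \<le> M \<and> 0 < g k (real M - 2)", OF this]
  show "5 \<le> threshold k" "0 < g k (real (threshold k) - 2)"
    unfolding threshold_def by auto
qed

text \<open>Take the largest power \<open>4 ^ P \<le> M\<close> and put \<open>q = P - 1\<close>.
  Positivity of \<open>g\<close> bounds \<open>k * P\<close> by a small multiple of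
  \<open>M\<close>, and \<open>M < 16 * 4 ^ q\<close>.\<close>

lemma threshold_scale:
  obtains q where "4 ^ Suc q \<le> threshold k" "10 * k * Suc q \<le> 4 ^ q"
proof -
  define M where "M = threshold k"
  have M: "5 \<le> M" "0 < g k (real M - 2)" unfolding M_def by (rule threshold_properties)+
  obtain P where P: "4 ^ P \<le> M" "M < 4 ^ Suc P"
    using ex_power_ivl1[of 4 M] M(1) by auto
  obtain q where q: "P = Suc q"
    using P(2) M(1) by (cases P) auto
  define x where "x = real M - 2"
  have x: "3 \<le> x" using M(1) by (simp add: x_def)
  have lnx: "0 < ln x" using x by simp
  have ln4: "0 < ln (4::real)" by simp
  \<comment> \<open>Here \<open>320 = 10 * 16 * 2\<close>: 10 from the counting criterion, 16 from
    \<open>M < 4 ^ (q + 2)\<close>, and 2 from \<open>4 ^ P \<le> x ^ 2\<close>, where the square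
    absorbs the shift \<open>M = x + 2\<close>.\<close>
  have "k * (320 / ln 4) \<le> k * (4 * exp 1 * 432\<^sup>2 / ln 4)"
  proof (intro mult_left_mono divide_right_mono)
    show "320 \<le> 4 * exp 1 * (432::real)\<^sup>2"
      using exp_ge_add_one_self[of "1::real"] by simp
  qed auto
  also have "\<dots> < x / ln x" using M(2) by (simp add: g_def x_def)
  finally have 1: "k * 320 * (ln x / ln 4) < x" using lnx ln4 by (simp add: field_simps)
  have "4 ^ P \<le> x ^ 2"
  proof -
    have "real (4 ^ P) \<le> real M" using P(1) by (simp only: of_nat_le_iff)
    also have "\<dots> = x + 2" by (simp add: x_def)
    also have "\<dots> \<le> 3 * x" using x by simp
    also have "\<dots> \<le> x ^ 2" using x by (simp add: power2_eq_square)
    finally show ?thesis by simp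
  qed
  then have "ln (4 ^ P) \<le> ln (x ^ 2)" using x by simp
  then have "P * ln 4 \<le> 2 * ln x" using x by (simp add: ln_realpow)
  then have "P \<le> 2 * (ln x / ln 4)" using ln4 by (simp add: field_simps)
  then have "real (160 * k) * real P \<le> real (160 * k) * (2 * (ln x / ln 4))"
    by (rule mult_left_mono) simp
  also have "\<dots> = k * 320 * (ln x / ln 4)" by simp
  finally have "real (160 * k * P) < x" using 1 by simp
  also have "\<dots> < real M" by (simp add: x_def)
  finally have "160 * k * P < M" by (simp only: of_nat_less_iff)
  then have "16 * (10 * k * Suc q) \<le> 16 * 4 ^ q" using P(2) q by simp
  then have "10 * k * Suc q \<le> 4 ^ q" by simp
  then show thesis using that P(1) q M_def by blast
qed

theorem theorem1p1:
  fixes k :: nat and b :: "nat \<Rightarrow> nat"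
  assumes "k \<ge> 2"
    and "\<forall>i\<in>{1..k}. b i \<ge> threshold k"
  shows "infinite {N::nat. \<forall>i\<in>{1..k}. zero_free (b i) N}"
proof -
  obtain q where q: "4 ^ Suc q \<le> threshold k" "10 * k * Suc q \<le> 4 ^ q"
    by (rule threshold_scale)
  let ?B = "b ` {1..k}"
  \<comment> \<open>Bases may coincide, so only an inequality holds.\<close>
  have "card ?B \<le> k" using card_image_le[of "{1..k}" b] by simp
  then have "10 * card ?B * Suc q \<le> 10 * k * Suc q" by (intro mult_mono) auto
  with q assms(2) have "infinite {N. \<forall>c\<in>?B. zero_free c N}"
    by (intro infinite_zero_free[where q = q]) (auto intro: order_trans)
  then show ?thesis by simp
qed

end
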